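(* Let $P\subset\mathbb{R}^2$ be a regular pentagon and let $K\in\mathcal{K}^2$. Then \[ R(K,P)\leq \frac{2}{1+\sqrt5}\,D(K,P)=\frac{\sqrt5-1}{2}\,D(K,P). \] Moreover, there exist triangles $T$ and $T'$ attaining equality in this inequality (i.e. for $K=T$ and for $K=T'$), such that $T$ is an isosceles triangle with exactly two diametrical edges, whereas $T'$ is an equilateral triangle.
   Context: $\mathcal{K}^n$ denotes the set of convex bodies, i.e. (nonempty) convex compact subsets of $\mathbb{R}^n$. For $K,C\in\mathcal{K}^n$, with $C$ full-dimensional (the gauge): the circumradius $R(K,C)$ is the smallest $\lambda\geq 0$ such that a translate of $K$ is contained in $\lambda C$; the diameter is $D(K,C)=2\max_{x,y\in K}R(\{x,y\},C)$. The length of an edge $[x,y]$ with respect to $P$ is $D([x,y],P)$. An edge $[x,y]$ of a triangle $T$ is diametrical if $D([x,y],P)=D(T,P)$. A triangle is called equilateral (here: with respect to $P$) if all its edges have the same length with respect to $P$, i.e. all three edges are diametrical. *)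

theory Defs
  imports "HOL-Analysis.Analysis"
begin

definition convex_body :: "'a::euclidean_space set \<Rightarrow> bool" where
  "convex_body K \<longleftrightarrow> K \<noteq> {} \<and> convex K \<and> compact K"

text \<open>For a compact set \<open>K\<close> and a full-dimensional convex body \<open>C\<close> the set below is nonempty
  and closed, so its infimum is the smallest admissible dilation factor.\<close>

definition gauge_circumradius :: "'a::euclidean_space set \<Rightarrow> 'a set \<Rightarrow> real" where
  "gauge_circumradius K C = Inf {l. l \<ge> 0 \<and> (\<exists>t. (\<lambda>x. t + x) ` K \<subseteq> (\<lambda>x. l *\<^sub>R x) ` C)}"

text \<open>For convex bodies with \<open>C\<close> full-dimensional, the supremum is a maximum, since the circumradius of
  \<open>{x, y}\<close> depends continuously on \<open>(x, y)\<close>. The gauge need not be symmetric.\<close>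

definition gauge_diameter :: "'a::euclidean_space set \<Rightarrow> 'a set \<Rightarrow> real" where
  "gauge_diameter K C = 2 * (SUP (x, y) \<in> K \<times> K. gauge_circumradius {x, y} C)"

definition regular_pentagon :: "(real ^ 2) set \<Rightarrow> bool" where
  "regular_pentagon P \<longleftrightarrow> (\<exists>c r \<theta>. r > 0 \<and>
     P = convex hull ((\<lambda>k::nat. c + r *\<^sub>R
           (vector [cos (\<theta> + 2 * pi * real k / 5), sin (\<theta> + 2 * pi * real k / 5)] :: real ^ 2)) ` {..<5}))"

definition is_triangle :: "real ^ 2 \<Rightarrow> real ^ 2 \<Rightarrow> real ^ 2 \<Rightarrow> bool" where
  "is_triangle a b c \<longleftrightarrow> \<not> collinear {a, b, c}"

definition triangle_hull :: "real ^ 2 \<Rightarrow> real ^ 2 \<Rightarrow> real ^ 2 \<Rightarrow> (real ^ 2) set" where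
  "triangle_hull a b c = convex hull {a, b, c}"

definition triangle_edges :: "real ^ 2 \<Rightarrow> real ^ 2 \<Rightarrow> real ^ 2 \<Rightarrow> (real ^ 2) set set" where
  "triangle_edges a b c = {closed_segment a b, closed_segment b c, closed_segment c a}"

definition diametrical_edges ::
    "real ^ 2 \<Rightarrow> real ^ 2 \<Rightarrow> real ^ 2 \<Rightarrow> (real ^ 2) set \<Rightarrow> (real ^ 2) set set" where
  "diametrical_edges a b c P =
     {e \<in> triangle_edges a b c. gauge_diameter e P = gauge_diameter (triangle_hull a b c) P}"

text \<open>``Isosceles'' refers to Euclidean lengths, whereas ``equilateral'' refers to lengths
  with respect to the gauge.\<close>

definition isosceles :: "real ^ 2 \<Rightarrow> real ^ 2 \<Rightarrow> real ^ 2 \<Rightarrow> bool" where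
  "isosceles a b c \<longleftrightarrow> dist a b = dist a c \<or> dist b a = dist b c \<or> dist c a = dist c b"

definition equilateral_wrt :: "(real ^ 2) set \<Rightarrow> real ^ 2 \<Rightarrow> real ^ 2 \<Rightarrow> real ^ 2 \<Rightarrow> bool" where
  "equilateral_wrt P a b c \<longleftrightarrow>
     (\<forall>e \<in> triangle_edges a b c. \<forall>f \<in> triangle_edges a b c. gauge_diameter e P = gauge_diameter f P)"

end

theory Submission
  imports Defs
begin

text \<open>Write \<open>\<phi>\<close> for the golden ratio and \<open>e\<^sub>k\<close>, with \<open>k\<close> modulo 5, for the unit vectors pointing from the
  centre of \<open>P\<close> to its vertices. The edges of \<open>P\<close> have outer normals \<open>- e\<^sub>k\<close>, so \<open>P\<close> is cut out by five
  half-planes (\<open>pentagon_halfspaces\<close>), and all five widths of \<open>P\<close> in the directions \<open>e\<^sub>k\<close> are equal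
  to some \<open>\<omega>\<close>. Finding a translate of \<open>K\<close> inside \<open>l P\<close> is therefore a system of five linear
  inequalities \<open>e\<^sub>k \<bullet> t \<ge> b\<^sub>k\<close> for a translation vector \<open>t\<close>. By the dependency
  \<open>\<phi> e\<^sub>k + e\<^sub>k\<^sub>+\<^sub>2 + e\<^sub>k\<^sub>-\<^sub>2 = 0\<close>, which involves the three normals of an acute triangle formed by edge
  lines, solvability forces \<open>\<phi> b\<^sub>k + b\<^sub>k\<^sub>+\<^sub>2 + b\<^sub>k\<^sub>-\<^sub>2 \<le> 0\<close> for every \<open>k\<close>, and these five conditions
  also suffice (\<open>triple_imp_fits\<close>). In terms of points of \<open>K\<close> they say that
  \<open>e\<^sub>k\<^sub>+\<^sub>2 \<bullet> (x - y) + e\<^sub>k\<^sub>-\<^sub>2 \<bullet> (x - z) \<le> l \<phi> \<omega>\<close> for all \<open>x, y, z \<in> K\<close>.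

  Applied to a pair of points, the criterion shows that \<open>R({x, y}, P)\<close> is the maximum of
  \<open>\<bar>e\<^sub>k \<bullet> (x - y)\<bar> / \<omega>\<close> over \<open>k\<close>. Hence \<open>\<bar>e\<^sub>k \<bullet> (x - y)\<bar> \<le> \<omega> D(K, P) / 2\<close> for all \<open>x, y \<in> K\<close>, so each of the two
  summands in the criterion is at most half of \<open>\<omega> D(K, P)\<close>, and the criterion holds for
  \<open>l = D(K, P) / \<phi>\<close>. This is the inequality (\<open>compact_fits_diameter\<close>).

  Equality holds for a triangle \<open>u v w\<close> as soon as both summands are extremal, that is, if
  \<open>e\<^sub>2 \<bullet> (u - v)\<close> and \<open>e\<^sub>3 \<bullet> (u - w)\<close> both equal the largest width \<open>W\<close> of the triangle in the
  directions \<open>e\<^sub>k\<close> (\<open>hull_circumradius_eq\<close>). The edge \<open>v w\<close> is then free to be shorter than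
  the other two, or of the same length, which produces the two kinds of extremal
  triangles.\<close>

section \<open>The golden ratio\<close>

definition golden :: real where
  "golden = (1 + sqrt 5) / 2"

lemma golden_square: "golden * golden = golden + 1"
proof -
  have "sqrt 5 * sqrt 5 = (5::real)" by simp
  then show ?thesis unfolding golden_def by (simp add: field_simps)
qed

lemma golden_gt_1: "golden > 1"
  unfolding golden_def by (simp add: real_less_rsqrt)

text \<open>The angle \<open>\<alpha> = 2\<pi>/5\<close> satisfies \<open>cos 3\<alpha> = cos 2\<alpha>\<close>, a cubic equation for \<open>cos \<alpha>\<close> that has the
  root 1 and two more, of which only one is positive.\<close>

lemma cos_two_fifths_pi: "cos (2 * pi / 5) = (golden - 1) / 2"
proof -
  define c where "c = cos (2 * pi / 5)"
  have c2: "cos (2 * (2 * pi / 5)) = 2 * c^2 - 1"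
    unfolding c_def by (rule cos_double_cos)
  have c3: "cos (3 * (2 * pi / 5)) = 4 * c^3 - 3 * c"
    unfolding c_def by (rule cos_treble_cos)
  have "cos (3 * (2 * pi / 5)) = cos (2 * pi - 3 * (2 * pi / 5))"
    by (simp only: cos_diff cos_two_pi sin_two_pi mult_1 mult_zero_left add_0_right)
  also have "2 * pi - 3 * (2 * pi / 5) = 2 * (2 * pi / 5)" by simp
  finally have "4 * c^3 - 3 * c = 2 * c^2 - 1" using c2 c3 by simp
  then have "(c - 1) * (4 * c^2 + 2 * c - 1) = 0" by (simp add: algebra_simps power2_eq_square power3_eq_cube)
  moreover have "c < 1"
    using cos_monotone_0_pi[of 0 "2 * pi / 5"] by (simp add: c_def)
  ultimately have q: "4 * c^2 + 2 * c - 1 = 0" by simp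
  have cpos: "c > 0" unfolding c_def by (rule cos_gt_zero) auto
  have "(2 * c - (golden - 1)) * (2 * c + golden) = 4 * c^2 + 2 * c + golden - golden * golden"
    by (simp add: algebra_simps power2_eq_square)
  also have "\<dots> = 0" using q golden_square by simp
  finally have "2 * c = golden - 1" using cpos golden_gt_1 by auto
  then show ?thesis by (simp add: c_def)
qed

lemma golden_bounds: "golden > 8 / 5" "golden < 13 / 8"
proof -
  have "sqrt 5 > 11 / 5" by (rule real_less_rsqrt) (simp add: power2_eq_square)
  then show "golden > 8 / 5" by (simp add: golden_def)
  have "sqrt 5 < 9 / 4" by (rule real_less_lsqrt) (simp_all add: power2_eq_square)
  then show "golden < 13 / 8" by (simp add: golden_def)
qed

section \<open>Vertex directions of the regular pentagon\<close>

text \<open>The index is an integer, with period 5, so that every statement about one vertex covers all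
  of them by symmetry and \<open>k - 1\<close>, \<open>k - 2\<close> make sense.\<close>

definition dir :: "real \<Rightarrow> int \<Rightarrow> real ^ 2" where
  "dir \<theta> k = vector [cos (\<theta> + 2 * pi * real_of_int k / 5), sin (\<theta> + 2 * pi * real_of_int k / 5)]"

lemma dir_add5: "dir \<theta> (k + 5) = dir \<theta> k"
proof -
  have "\<theta> + 2 * pi * real_of_int (k + 5) / 5 = (\<theta> + 2 * pi * real_of_int k / 5) + 2 * pi"
    by (simp add: field_simps)
  then show ?thesis unfolding dir_def by (simp only: cos_periodic sin_periodic)
qed

lemma periodic5_cases:
  fixes Q :: "int \<Rightarrow> bool"
  assumes per: "\<And>j. Q (j + 5) = Q j"
    and "Q k" "Q (k + 1)" "Q (k + 2)" "Q (k + 3)" "Q (k + 4)"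
  shows "Q j"
proof -
  have up: "Q (i + 5 * int n) = Q i" for i n
  proof (induction n)
    case (Suc n)
    have "i + 5 * int (Suc n) = (i + 5 * int n) + 5" by simp
    then show ?case using per Suc by metis
  qed simp
  have shift: "Q (i + 5 * m) = Q i" for i m
  proof (cases "m \<ge> 0")
    case True
    then show ?thesis using up[of i "nat m"] by simp
  next
    case False
    then show ?thesis using up[of "i + 5 * m" "nat (- m)"] by simp
  qed
  define i where "i = (j - k) mod 5"
  have j: "j = (k + i) + 5 * ((j - k) div 5)" unfolding i_def by simp
  have "i = 0 \<or> i = 1 \<or> i = 2 \<or> i = 3 \<or> i = 4"
    unfolding i_def by presburger
  then have "Q (k + i)" using assms(2-6) by (elim disjE) simp_all
  then show ?thesis using shift[of "k + i" "(j - k) div 5"] j by simp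
qed

lemma periodic5_attains_max:
  fixes f :: "int \<Rightarrow> real"
  assumes per: "\<And>j. f (j + 5) = f j"
  obtains k where "\<And>j. f j \<le> f k"
proof -
  have "Max (f ` {0..4}) \<in> f ` {0..4}" by (rule Max_in) auto
  then obtain k where k: "f k = Max (f ` {0..4})" by (metis imageE)
  have le: "f i \<le> f k" if "i \<in> {0..4}" for i
    unfolding k using that by (intro Max_ge) auto
  have "f j \<le> f k" for j
    by (rule periodic5_cases[where k = 0]) (use per le in auto)
  then show thesis by (rule that)
qed

lemma dir_neighbours: "dir \<theta> (k + 1) + dir \<theta> (k - 1) = (golden - 1) *\<^sub>R dir \<theta> k"
proof -
  define A where "A = \<theta> + 2 * pi * real_of_int k / 5"
  have p: "\<theta> + 2 * pi * real_of_int (k + 1) / 5 = A + 2 * pi / 5"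
    and m: "\<theta> + 2 * pi * real_of_int (k - 1) / 5 = A - 2 * pi / 5"
    unfolding A_def by (simp_all add: field_simps)
  show ?thesis
    unfolding dir_def p m A_def[symmetric]
    by (simp add: vec_eq_iff forall_2 cos_add cos_diff sin_add sin_diff cos_two_fifths_pi)
qed

text \<open>The linear dependency that governs the whole proof: the coefficients \<open>\<phi>, 1, 1\<close> are positive,
  so the three half-planes with these normals bound a triangle.\<close>

lemma dir_second_neighbours: "dir \<theta> (k + 2) + dir \<theta> (k - 2) = - golden *\<^sub>R dir \<theta> k"
proof -
  have "dir \<theta> (k + 2) + dir \<theta> (k - 2)
      = (dir \<theta> (k + 2) + dir \<theta> k) + (dir \<theta> k + dir \<theta> (k - 2)) - 2 *\<^sub>R dir \<theta> k"
    by (simp add: scaleR_2)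
  also have "\<dots> = (golden - 1) *\<^sub>R (dir \<theta> (k + 1) + dir \<theta> (k - 1)) - 2 *\<^sub>R dir \<theta> k"
    using dir_neighbours[of \<theta> "k + 1"] dir_neighbours[of \<theta> "k - 1"]
    by (simp add: scaleR_add_right add.commute[of k 2])
  also have "\<dots> = ((golden - 1) * (golden - 1) - 2) *\<^sub>R dir \<theta> k"
    by (simp only: dir_neighbours scaleR_scaleR scaleR_left_diff_distrib[of "(golden - 1) * (golden - 1)"])
  also have "(golden - 1) * (golden - 1) - 2 = - golden"
    using golden_square by (simp add: algebra_simps)
  finally show ?thesis .
qed

lemma dir_inner_0: "dir \<theta> k \<bullet> dir \<theta> k = 1"
  by (simp add: dir_def inner_vec_def sum_2 power2_eq_square[symmetric])

lemma dir_inner_1: "dir \<theta> k \<bullet> dir \<theta> (k + 1) = (golden - 1) / 2"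
proof -
  define A where "A = \<theta> + 2 * pi * real_of_int k / 5"
  have p: "\<theta> + 2 * pi * real_of_int (k + 1) / 5 = A + 2 * pi / 5"
    unfolding A_def by (simp add: field_simps)
  have "dir \<theta> k \<bullet> dir \<theta> (k + 1) = cos ((A + 2 * pi / 5) - A)"
    unfolding dir_def p A_def[symmetric] cos_diff by (simp add: inner_vec_def sum_2 algebra_simps)
  then show ?thesis by (simp add: cos_two_fifths_pi)
qed

lemma dir_inner_2: "dir \<theta> k \<bullet> dir \<theta> (k + 2) = - golden / 2"
proof -
  have "dir \<theta> (k + 2) = (golden - 1) *\<^sub>R dir \<theta> (k + 1) - dir \<theta> k"
    using dir_neighbours[of \<theta> "k + 1"] by (simp add: algebra_simps)
  then have "dir \<theta> k \<bullet> dir \<theta> (k + 2) = (golden - 1) * ((golden - 1) / 2) - 1"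
    by (simp add: inner_diff_right dir_inner_0 dir_inner_1)
  then show ?thesis using golden_square by (simp add: field_simps)
qed

lemma dir_inner_3: "dir \<theta> k \<bullet> dir \<theta> (k + 3) = - golden / 2"
  using dir_inner_2[of \<theta> "k + 3"] dir_add5[of \<theta> k] by (simp add: inner_commute add.assoc)

lemma dir_inner_4: "dir \<theta> k \<bullet> dir \<theta> (k + 4) = (golden - 1) / 2"
  using dir_inner_1[of \<theta> "k + 4"] dir_add5[of \<theta> k] by (simp add: inner_commute add.assoc)

lemma dir_basis:
  obtains a b where "z = a *\<^sub>R dir \<theta> k + b *\<^sub>R dir \<theta> (k + 1)"
proof -
  define A where "A = \<theta> + 2 * pi * real_of_int k / 5"
  define B where "B = A + 2 * pi / 5"
  define s where "s = sin (2 * pi / 5)"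
  have p: "\<theta> + 2 * pi * real_of_int (k + 1) / 5 = B"
    unfolding A_def B_def by (simp add: field_simps)
  have spos: "s > 0" unfolding s_def by (rule sin_gt_zero) auto
  have "s = sin (B - A)" by (simp add: s_def B_def)
  then have s: "s = sin B * cos A - cos B * sin A" by (simp add: sin_diff)
  define a where "a = (z $ 1 * sin B - z $ 2 * cos B) / s"
  define b where "b = (z $ 2 * cos A - z $ 1 * sin A) / s"
  have "s * (a * cos A + b * cos B) = z $ 1 * s"
    unfolding a_def b_def using spos by (simp add: field_simps) (simp add: s algebra_simps)
  moreover have "s * (a * sin A + b * sin B) = z $ 2 * s"
    unfolding a_def b_def using spos by (simp add: field_simps) (simp add: s algebra_simps)
  ultimately have "z = a *\<^sub>R dir \<theta> k + b *\<^sub>R dir \<theta> (k + 1)"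
    unfolding dir_def p A_def[symmetric] using spos by (simp add: vec_eq_iff forall_2)
  then show thesis by (rule that)
qed

lemma dir_prescribed_inner:
  obtains t where "dir \<theta> k \<bullet> t = p" "dir \<theta> (k + 1) \<bullet> t = q"
proof -
  define h where "h = (golden - 1) / 2"
  have h: "0 < h" "h < 1" using golden_gt_1 golden_bounds by (simp_all add: h_def)
  define d where "d = 1 - h * h"
  have "h * h < 1 * 1" using h by (intro mult_strict_mono) auto
  then have d: "d > 0" by (simp add: d_def)
  define t where "t = ((p - h * q) / d) *\<^sub>R dir \<theta> k + ((q - h * p) / d) *\<^sub>R dir \<theta> (k + 1)"
  have i: "dir \<theta> k \<bullet> dir \<theta> (k + 1) = h" "dir \<theta> (k + 1) \<bullet> dir \<theta> k = h"
    using dir_inner_1[of \<theta> k] by (simp_all add: h_def inner_commute)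
  have "dir \<theta> k \<bullet> t = (p - h * q) / d + (q - h * p) / d * h"
    by (simp add: t_def inner_add_right dir_inner_0 i)
  also have "\<dots> = p" using d by (simp add: field_simps) (simp add: d_def algebra_simps)
  finally have 1: "dir \<theta> k \<bullet> t = p" .
  have "dir \<theta> (k + 1) \<bullet> t = (p - h * q) / d * h + (q - h * p) / d"
    by (simp add: t_def inner_add_right dir_inner_0 i)
  also have "\<dots> = q" using d by (simp add: field_simps) (simp add: d_def algebra_simps)
  finally show thesis using 1 that by blast
qed

lemma zero_in_pentagon: "0 \<in> convex hull range (dir \<theta>)"
proof -
  have "{0..4::int} = {0,1,2,3,4}" by auto
  then have "(\<Sum>k\<in>{0..4}. dir \<theta> k) = dir \<theta> 0 + (dir \<theta> 1 + dir \<theta> 4) + (dir \<theta> 2 + dir \<theta> 3)"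
    by simp
  moreover have "dir \<theta> 1 + dir \<theta> 4 = (golden - 1) *\<^sub>R dir \<theta> 0"
    using dir_neighbours[of \<theta> 0] dir_add5[of \<theta> "-1"] by simp
  moreover have "dir \<theta> 2 + dir \<theta> 3 = - golden *\<^sub>R dir \<theta> 0"
    using dir_second_neighbours[of \<theta> 0] dir_add5[of \<theta> "-2"] by simp
  ultimately have "(\<Sum>k\<in>{0..4}. dir \<theta> k) = 0" by (simp add: algebra_simps)
  then have "0 = (\<Sum>k\<in>{0..4::int}. (1 / 5) *\<^sub>R dir \<theta> k)" by (simp add: scaleR_sum_right[symmetric])
  also have "\<dots> \<in> convex hull range (dir \<theta>)"
    by (rule convex_sum) (auto intro: hull_inc)
  finally show ?thesis .
qed

text \<open>To show that the half-planes cut out nothing more than the hull, take the vertex direction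
  \<open>e\<^sub>k\<close> with the largest inner product with \<open>z\<close>. Then \<open>z\<close> lies in the cone spanned by \<open>e\<^sub>k\<close> and one of
  its neighbours, and the half-plane of the edge joining these two vertices bounds the sum of the
  two coefficients by \<open>s\<close>.\<close>

lemma pentagon_halfspaces:
  assumes s: "s \<ge> 0"
  shows "z \<in> (\<lambda>x. s *\<^sub>R x) ` (convex hull range (dir \<theta>))
     \<longleftrightarrow> (\<forall>k. - (s * golden / 2) \<le> dir \<theta> k \<bullet> z)" (is "?L \<longleftrightarrow> ?R")
proof
  assume ?L
  then obtain x where x: "x \<in> convex hull range (dir \<theta>)" and z: "z = s *\<^sub>R x" by auto
  show ?R
  proof
    fix k
    have "- (golden / 2) \<le> dir \<theta> k \<bullet> dir \<theta> j" for j
      by (rule periodic5_cases[where k = k])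
        (use golden_gt_1 in \<open>auto simp: dir_add5 dir_inner_0 dir_inner_1 dir_inner_2 dir_inner_3 dir_inner_4\<close>)
    then have "convex hull range (dir \<theta>) \<subseteq> {y. dir \<theta> k \<bullet> y \<ge> - (golden / 2)}"
      by (intro hull_minimal convex_halfspace_ge) auto
    then have "- (golden / 2) \<le> dir \<theta> k \<bullet> x" using x by auto
    from mult_left_mono[OF this s] show "- (s * golden / 2) \<le> dir \<theta> k \<bullet> z" by (simp add: z)
  qed
next
  assume R: ?R
  \<comment> \<open>\<open>dir \<theta> l\<close> is opposite to the edge joining the vertices \<open>i\<close> and \<open>j\<close>.\<close>
  have cone: ?L
    if z: "z = a *\<^sub>R dir \<theta> i + b *\<^sub>R dir \<theta> j" and ab: "a \<ge> 0" "b \<ge> 0"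
      and o: "dir \<theta> l \<bullet> dir \<theta> i = - golden / 2" "dir \<theta> l \<bullet> dir \<theta> j = - golden / 2" for a b i j l
  proof -
    have "dir \<theta> l \<bullet> z = - ((a + b) * golden / 2)"
      by (simp add: z inner_add_right o algebra_simps add_divide_distrib)
    then have "(a + b) * golden \<le> s * golden" using R[rule_format, of l] by simp
    then have le: "a + b \<le> s" using golden_gt_1 by simp
    have i: "dir \<theta> i \<in> convex hull range (dir \<theta>)" and j: "dir \<theta> j \<in> convex hull range (dir \<theta>)"
      by (auto intro: hull_inc)
    show ?L
    proof (cases "s = 0")
      case True
      then have "a = 0" "b = 0" using ab le by linarith+
      then have "z = 0" using z by simp
      then show ?thesis using zero_in_pentagon[of \<theta>] True by force
    next
      case False
      with s have sp: "s > 0" by simp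
      have "{0, dir \<theta> i, dir \<theta> j} \<subseteq> convex hull range (dir \<theta>)" using zero_in_pentagon i j by auto
      then have "convex hull {0, dir \<theta> i, dir \<theta> j} \<subseteq> convex hull range (dir \<theta>)"
        by (simp add: hull_minimal)
      moreover have "(1 - (a + b) / s) *\<^sub>R 0 + (a / s) *\<^sub>R dir \<theta> i + (b / s) *\<^sub>R dir \<theta> j
            \<in> convex hull {0, dir \<theta> i, dir \<theta> j}"
        unfolding convex_hull_3 mem_Collect_eq
        by (intro exI conjI, rule refl) (use ab le sp in \<open>auto simp: field_simps\<close>)
      moreover have "z = s *\<^sub>R ((1 - (a + b) / s) *\<^sub>R 0 + (a / s) *\<^sub>R dir \<theta> i + (b / s) *\<^sub>R dir \<theta> j)"
        using sp by (simp add: z scaleR_add_right)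
      ultimately show ?thesis by blast
    qed
  qed
  obtain k where k: "\<And>j. dir \<theta> j \<bullet> z \<le> dir \<theta> k \<bullet> z"
    by (rule periodic5_attains_max[of "\<lambda>j. dir \<theta> j \<bullet> z"]) (auto simp: dir_add5)
  \<comment> \<open>If \<open>b \<ge> 0\<close>, this gives \<open>a \<ge> 0\<close>; if \<open>b < 0\<close>, it is applied after replacing \<open>dir \<theta> (k + 1)\<close> by the
    other neighbour, whose coefficient is \<open>- b\<close>.\<close>
  have dominant: "b \<le> a" if z: "z = a *\<^sub>R dir \<theta> k + b *\<^sub>R dir \<theta> j"
      and i: "dir \<theta> k \<bullet> dir \<theta> j = (golden - 1) / 2" for a b j
  proof -
    have "(b - a) * (1 - (golden - 1) / 2) \<le> 0"
      using k[of j] unfolding z inner_add_right inner_scaleR_right dir_inner_0 i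
        inner_commute[of "dir \<theta> j" "dir \<theta> k"] by argo
    then show ?thesis using golden_bounds by (simp add: mult_le_0_iff)
  qed
  have km: "dir \<theta> k \<bullet> dir \<theta> (k - 1) = (golden - 1) / 2"
    using dir_inner_1[of \<theta> "k - 1"] by (simp add: inner_commute)
  obtain a b where z: "z = a *\<^sub>R dir \<theta> k + b *\<^sub>R dir \<theta> (k + 1)" by (rule dir_basis)
  show ?L
  proof (cases "b \<ge> 0")
    case True
    have "b \<le> a" by (rule dominant[OF z dir_inner_1])
    then show ?thesis using cone[OF z, of "k + 3"] True dir_inner_3[of \<theta> k] dir_inner_2[of \<theta> "k + 1"]
      by (simp add: inner_commute add.assoc)
  next
    case False
    have "dir \<theta> (k + 1) = (golden - 1) *\<^sub>R dir \<theta> k - dir \<theta> (k - 1)"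
      using dir_neighbours[of \<theta> k] by (simp add: algebra_simps)
    with z have "z = a *\<^sub>R dir \<theta> k + b *\<^sub>R ((golden - 1) *\<^sub>R dir \<theta> k - dir \<theta> (k - 1))"
      by (simp only:)
    then have z': "z = (a + b * (golden - 1)) *\<^sub>R dir \<theta> k + (- b) *\<^sub>R dir \<theta> (k - 1)"
      by (simp only: scaleR_diff_right scaleR_scaleR scaleR_add_left scaleR_minus_left) simp
    have "- b \<le> a + b * (golden - 1)" by (rule dominant[OF z' km])
    then show ?thesis using cone[OF z', of "k + 2"] False dir_inner_2[of \<theta> k] dir_inner_3[of \<theta> "k - 1"]
      by (simp add: inner_commute add.commute[of k 2])
  qed
qed

section \<open>Translates contained in a dilated pentagon\<close>

locale pentagon_gauge =
  fixes P :: "(real ^ 2) set" and c :: "real ^ 2" and r \<theta> :: real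
  assumes r_pos: "r > 0"
    and P_eq: "P = (\<lambda>z. c + r *\<^sub>R z) ` (convex hull range (dir \<theta>))"
begin

text \<open>The inradius of \<open>P\<close> is \<open>r \<phi> / 2\<close> and its circumradius is \<open>r\<close>; a vertex is opposite to an edge, so
  the width in the directions \<open>e\<^sub>k\<close> is the sum of the two.\<close>

definition width :: real where
  "width = r * (1 + golden / 2)"

definition fits :: "(real ^ 2) set \<Rightarrow> real \<Rightarrow> bool" where
  "fits K l \<longleftrightarrow> l \<ge> 0 \<and> (\<exists>t. (\<lambda>x. t + x) ` K \<subseteq> (\<lambda>x. l *\<^sub>R x) ` P)"

lemma width_pos: "width > 0"
  using r_pos golden_gt_1 by (simp add: width_def)

lemma golden_width: "golden * width = r * golden / 2 * (golden + 2)"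
  by (simp add: width_def algebra_simps)

lemma mem_dilate_iff:
  assumes "l \<ge> 0"
  shows "y \<in> (\<lambda>x. l *\<^sub>R x) ` P \<longleftrightarrow> (\<forall>k. - (l * r * golden / 2) \<le> dir \<theta> k \<bullet> (y - l *\<^sub>R c))"
proof -
  have "y \<in> (\<lambda>x. l *\<^sub>R x) ` P \<longleftrightarrow> y - l *\<^sub>R c \<in> (\<lambda>x. (l * r) *\<^sub>R x) ` (convex hull range (dir \<theta>))"
    unfolding P_eq image_image image_iff by (simp add: algebra_simps)
  also have "\<dots> \<longleftrightarrow> (\<forall>k. - (l * r * golden / 2) \<le> dir \<theta> k \<bullet> (y - l *\<^sub>R c))"
    using assms r_pos by (intro pentagon_halfspaces) auto
  finally show ?thesis .
qed

lemma fits_iff: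
  "fits K l \<longleftrightarrow> l \<ge> 0 \<and> (\<exists>t. \<forall>x\<in>K. \<forall>k. - (l * r * golden / 2) \<le> dir \<theta> k \<bullet> (x + t))"
proof (cases "l \<ge> 0")
  case True
  have "(\<exists>t. (\<lambda>x. t + x) ` K \<subseteq> (\<lambda>x. l *\<^sub>R x) ` P)
      \<longleftrightarrow> (\<exists>t. \<forall>x\<in>K. \<forall>k. - (l * r * golden / 2) \<le> dir \<theta> k \<bullet> (x + (t - l *\<^sub>R c)))"
    by (simp add: image_subset_iff mem_dilate_iff[OF True] algebra_simps)
  also have "\<dots> \<longleftrightarrow> (\<exists>t. \<forall>x\<in>K. \<forall>k. - (l * r * golden / 2) \<le> dir \<theta> k \<bullet> (x + t))"
    by (metis add_diff_cancel_right')
  finally show ?thesis using True by (simp add: fits_def)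
qed (simp add: fits_def)

text \<open>Add up the half-plane inequalities for \<open>x\<close>, \<open>y\<close>, \<open>z\<close> with weights \<open>\<phi>, 1, 1\<close>: the translation
  vector cancels by \<open>dir_second_neighbours\<close>.\<close>

lemma fits_imp_triple:
  assumes "fits K l" "x \<in> K" "y \<in> K" "z \<in> K"
  shows "dir \<theta> (k + 2) \<bullet> (x - y) + dir \<theta> (k - 2) \<bullet> (x - z) \<le> l * (golden * width)"
proof -
  define p where "p = l * r * golden / 2"
  obtain t where t: "\<And>x k. x \<in> K \<Longrightarrow> - p \<le> dir \<theta> k \<bullet> (x + t)"
    using assms(1) by (auto simp: fits_iff p_def)
  have "dir \<theta> (k + 2) \<bullet> (x + t) + dir \<theta> (k - 2) \<bullet> (x + t) = - golden * (dir \<theta> k \<bullet> (x + t))"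
    unfolding inner_add_left[symmetric] dir_second_neighbours by simp
  moreover have "golden * - p \<le> golden * (dir \<theta> k \<bullet> (x + t))"
    using t[OF assms(2), of k] golden_gt_1 by (intro mult_left_mono) auto
  moreover note t[OF assms(3), of "k + 2"] t[OF assms(4), of "k - 2"]
  moreover have "l * (golden * width) = golden * p + 2 * p"
    by (simp add: golden_width p_def field_simps)
  ultimately show ?thesis by (simp add: inner_add_right inner_diff_right)
qed

text \<open>Only the support values of \<open>K\<close> matter, so the task is to solve \<open>e\<^sub>j \<bullet> t \<ge> b\<^sub>j\<close> for all \<open>j\<close>, given
  \<open>\<phi> b\<^sub>k + b\<^sub>k\<^sub>+\<^sub>2 + b\<^sub>k\<^sub>-\<^sub>2 \<le> 0\<close> for all \<open>k\<close>. Choose \<open>k\<close> for which the left-hand side is largest and take for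
  \<open>t\<close> the intersection point of the lines \<open>e\<^sub>k\<^sub>\<plusminus>\<^sub>2 \<bullet> t = b\<^sub>k\<^sub>\<plusminus>\<^sub>2\<close>. In linear programming terms, the choice of
  \<open>k\<close> is dual optimal and \<open>t\<close> is the matching primal solution. The slacks \<open>d\<^sub>j = b\<^sub>j - e\<^sub>j \<bullet> t\<close> have the same triple
  sums as the \<open>b\<^sub>j\<close>; as \<open>d\<^sub>k\<^sub>+\<^sub>2 = d\<^sub>k\<^sub>-\<^sub>2 = 0\<close>, the sum at \<open>k\<close> is \<open>\<phi> d\<^sub>k\<close>, and comparing with
  the sums at \<open>k + 2\<close> and \<open>k + 3\<close> bounds the two remaining slacks by \<open>(\<phi> - 1) d\<^sub>k \<le> 0\<close>.\<close>

lemma triple_imp_fits: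
  assumes K: "compact K" "K \<noteq> {}" and l: "l \<ge> 0"
    and triple: "\<And>k x y z. x \<in> K \<Longrightarrow> y \<in> K \<Longrightarrow> z \<in> K \<Longrightarrow>
      dir \<theta> (k + 2) \<bullet> (x - y) + dir \<theta> (k - 2) \<bullet> (x - z) \<le> l * (golden * width)"
  shows "fits K l"
proof -
  have "\<exists>m. (\<exists>x\<in>K. m = v \<bullet> x) \<and> (\<forall>y\<in>K. m \<le> v \<bullet> y)" for v
  proof -
    have "continuous_on K (\<lambda>x. v \<bullet> x)" by (intro continuous_intros)
    from continuous_attains_inf[OF K this] show ?thesis by blast
  qed
  then obtain m where m_attained: "\<And>v. \<exists>x\<in>K. m v = v \<bullet> x" and m_le: "\<And>v y. y \<in> K \<Longrightarrow> m v \<le> v \<bullet> y"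
    by metis
  define b where "b k = - (l * r * golden / 2) - m (dir \<theta> k)" for k
  have b_per: "b (k + 5) = b k" for k by (simp add: b_def dir_add5)
  have b_triple: "golden * b k + b (k + 2) + b (k - 2) \<le> 0" for k
  proof -
    obtain x where x: "x \<in> K" "m (dir \<theta> k) = dir \<theta> k \<bullet> x" using m_attained by blast
    obtain y where y: "y \<in> K" "m (dir \<theta> (k + 2)) = dir \<theta> (k + 2) \<bullet> y" using m_attained by blast
    obtain z where z: "z \<in> K" "m (dir \<theta> (k - 2)) = dir \<theta> (k - 2) \<bullet> z" using m_attained by blast
    have "dir \<theta> (k + 2) \<bullet> x + dir \<theta> (k - 2) \<bullet> x = - golden * (dir \<theta> k \<bullet> x)"
      unfolding inner_add_left[symmetric] dir_second_neighbours by simp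
    with triple[OF x(1) y(1) z(1), of k]
    have "- golden * m (dir \<theta> k) - m (dir \<theta> (k + 2)) - m (dir \<theta> (k - 2)) \<le> l * (golden * width)"
      by (simp add: x y z inner_diff_right)
    then show ?thesis by (simp add: b_def golden_width field_simps)
  qed
  have "golden * b (j + 5) + b (j + 5 + 2) + b (j + 5 - 2) = golden * b j + b (j + 2) + b (j - 2)" for j
    using b_per[of j] b_per[of "j + 2"] b_per[of "j - 2"] by (simp add: algebra_simps)
  then obtain k
    where k: "\<And>j. golden * b j + b (j + 2) + b (j - 2) \<le> golden * b k + b (k + 2) + b (k - 2)"
    by (rule periodic5_attains_max[of "\<lambda>j. golden * b j + b (j + 2) + b (j - 2)"]) blast
  obtain t where t2: "dir \<theta> (k + 2) \<bullet> t = b (k + 2)" and t3: "dir \<theta> (k + 2 + 1) \<bullet> t = b (k + 3)"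
    by (rule dir_prescribed_inner)
  define d where "d j = b j - dir \<theta> j \<bullet> t" for j
  have d_per: "d (j + 5) = d j" for j by (simp add: d_def b_per dir_add5)
  have d_shift: "golden * d j + d (j + 2) + d (j - 2) = golden * b j + b (j + 2) + b (j - 2)" for j
  proof -
    have "dir \<theta> (j + 2) \<bullet> t + dir \<theta> (j - 2) \<bullet> t = - golden * (dir \<theta> j \<bullet> t)"
      unfolding inner_add_left[symmetric] dir_second_neighbours by simp
    then show ?thesis by (simp add: d_def algebra_simps)
  qed
  have d2: "d (k + 2) = 0" and d3: "d (k + 3) = 0" using t2 t3 by (simp_all add: d_def add.assoc)
  have dm2: "d (k - 2) = 0" using d3 d_per[of "k - 2"] by (simp add: add.commute[of 3 k])
  have d_max: "golden * d j + d (j + 2) + d (j - 2) \<le> golden * d k" for j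
    using k[of j] d_shift[of j] d_shift[of k] d2 dm2 by simp
  have gd0: "golden * d k \<le> 0"
    using b_triple[of k] d_shift[of k] d2 dm2 by simp
  then have d0: "d k \<le> 0" using golden_gt_1 by (simp add: mult_le_0_iff)
  have gd: "(golden - 1) * d k \<le> 0" using d0 golden_gt_1 by (simp add: mult_le_0_iff)
  have d4: "d (k + 4) \<le> 0"
    using d_max[of "k + 2"] d2 gd by (simp add: add.assoc left_diff_distrib)
  have d1: "d (k + 1) \<le> 0"
    using d_max[of "k + 3"] d3 gd d_per[of k] by (simp add: left_diff_distrib add.commute[of 1 k] add.commute[of 5 k])
  have d_le: "d j \<le> 0" for j
    by (rule periodic5_cases[where k = k]) (use d_per d0 d1 d2 d3 d4 in auto)
  have "- (l * r * golden / 2) \<le> dir \<theta> j \<bullet> (x + t)" if "x \<in> K" for x j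
    using d_le[of j] m_le[OF that, of "dir \<theta> j"] by (simp add: d_def b_def inner_add_right)
  then show ?thesis using l by (auto simp: fits_iff)
qed

section \<open>Circumradius of a pair and diameter\<close>

lemma gauge_circumradius_eq: "gauge_circumradius K P = Inf {l. fits K l}"
  by (simp add: gauge_circumradius_def fits_def)

lemma fits_imp_circumradius_le: "fits K l \<Longrightarrow> gauge_circumradius K P \<le> l"
  unfolding gauge_circumradius_eq by (rule cInf_lower) (auto simp: bdd_below_def fits_def)

lemma circumradius_geI:
  assumes "fits K l0" "\<And>l. fits K l \<Longrightarrow> m \<le> l"
  shows "m \<le> gauge_circumradius K P"
  unfolding gauge_circumradius_eq using assms by (intro cInf_greatest) auto

text \<open>The special case \<open>y = z\<close> of \<open>fits_imp_triple\<close>, where the sum collapses to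
  \<open>- \<phi> e\<^sub>k \<bullet> (x - y)\<close>.\<close>

lemma fits_imp_width_le:
  assumes "fits K l" "x \<in> K" "y \<in> K"
  shows "\<bar>dir \<theta> k \<bullet> (x - y)\<bar> \<le> l * width"
proof -
  have "- (dir \<theta> k \<bullet> (u - v)) \<le> l * width" if "u \<in> K" "v \<in> K" for u v
  proof -
    have "dir \<theta> (k + 2) \<bullet> (u - v) + dir \<theta> (k - 2) \<bullet> (u - v) = - golden * (dir \<theta> k \<bullet> (u - v))"
      unfolding inner_add_left[symmetric] dir_second_neighbours by simp
    with fits_imp_triple[OF assms(1) that that(2), of k]
    have "golden * - (dir \<theta> k \<bullet> (u - v)) \<le> golden * (l * width)" by (simp add: mult_ac)
    then show ?thesis using golden_gt_1 by (subst (asm) mult_le_cancel_left_pos) auto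
  qed
  from this[OF assms(2,3)] this[OF assms(3,2)] show ?thesis
    by (simp add: inner_diff_right abs_le_iff)
qed

text \<open>Of three points taken from a pair, two coincide, so the sum in \<open>triple_imp_fits\<close> reduces to a
  single inner product, up to the factor \<open>\<phi>\<close>.\<close>

lemma pair_fitsI:
  assumes R: "\<And>k. \<bar>dir \<theta> k \<bullet> (x - y)\<bar> \<le> l * width"
  shows "fits {x, y} l"
proof (rule triple_imp_fits)
  have "0 \<le> l * width" using R[of 0] by linarith
  then show l: "l \<ge> 0" using width_pos by (simp add: zero_le_mult_iff)
  fix k u v w assume uvw: "u \<in> {x, y}" "v \<in> {x, y}" "w \<in> {x, y}"
  have *: "dir \<theta> k \<bullet> (u - v) \<le> l * width \<and> - (dir \<theta> k \<bullet> (u - v)) \<le> l * width" for k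
    using uvw R[of k] \<open>0 \<le> l * width\<close> by (auto simp: inner_diff_right abs_le_iff)
  have **: "dir \<theta> k \<bullet> (u - w) \<le> l * width \<and> - (dir \<theta> k \<bullet> (u - w)) \<le> l * width" for k
    using uvw R[of k] \<open>0 \<le> l * width\<close> by (auto simp: inner_diff_right abs_le_iff)
  have le: "l * width \<le> l * (golden * width)"
    using \<open>0 \<le> l * width\<close> golden_gt_1 mult_right_mono[of 1 golden "l * width"] by (simp add: mult_ac)
  consider "u = v" | "u = w" | "v = w" using uvw by auto
  then show "dir \<theta> (k + 2) \<bullet> (u - v) + dir \<theta> (k - 2) \<bullet> (u - w) \<le> l * (golden * width)"
  proof cases
    case 1
    then show ?thesis using **[of "k - 2"] le by simp
  next
    case 2
    then show ?thesis using *[of "k + 2"] le by simp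
  next
    case 3
    have "dir \<theta> (k + 2) \<bullet> (u - v) + dir \<theta> (k - 2) \<bullet> (u - v) = golden * - (dir \<theta> k \<bullet> (u - v))"
      unfolding inner_add_left[symmetric] dir_second_neighbours by simp
    also have "\<dots> \<le> golden * (l * width)"
      using *[of k] golden_gt_1 by (intro mult_left_mono) auto
    finally show ?thesis using 3 by (simp add: mult_ac)
  qed
qed auto

text \<open>Two uses: some dilate contains the pair, so that the infimum defining its circumradius is not
  over the empty set; and the circumradii of pairs from a bounded set are bounded, so that the
  supremum defining the diameter is a genuine one.\<close>

lemma pair_fits_norm: "fits {x, y} (norm (x - y) / width)"
proof (rule pair_fitsI)
  fix k
  have "norm (dir \<theta> k) = 1" by (simp add: norm_eq_sqrt_inner dir_inner_0)
  then show "\<bar>dir \<theta> k \<bullet> (x - y)\<bar> \<le> norm (x - y) / width * width"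
    using Cauchy_Schwarz_ineq2[of "dir \<theta> k" "x - y"] width_pos by simp
qed

lemma pair_circumradius_ge: "\<bar>dir \<theta> k \<bullet> (x - y)\<bar> \<le> gauge_circumradius {x, y} P * width"
proof -
  have "\<bar>dir \<theta> k \<bullet> (x - y)\<bar> / width \<le> gauge_circumradius {x, y} P"
    by (rule circumradius_geI[OF pair_fits_norm])
      (use fits_imp_width_le[of "{x, y}"] width_pos in \<open>simp add: pos_divide_le_eq\<close>)
  then show ?thesis using width_pos by (simp add: pos_divide_le_eq)
qed

lemma diameter_ge:
  assumes "bounded K" "x \<in> K" "y \<in> K"
  shows "2 * \<bar>dir \<theta> k \<bullet> (x - y)\<bar> \<le> gauge_diameter K P * width"
proof -
  have "gauge_circumradius {u, v} P \<le> diameter K / width" if "u \<in> K" "v \<in> K" for u v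
  proof -
    have "gauge_circumradius {u, v} P \<le> dist u v / width"
      using fits_imp_circumradius_le[OF pair_fits_norm] by (simp add: dist_norm)
    also have "\<dots> \<le> diameter K / width"
      using diameter_bounded_bound[OF assms(1) that] width_pos by (simp add: divide_right_mono)
    finally show ?thesis .
  qed
  then have "bdd_above ((\<lambda>(x, y). gauge_circumradius {x, y} P) ` (K \<times> K))"
    by (intro bdd_aboveI[of _ "diameter K / width"]) auto
  from cSUP_upper[OF _ this, of "(x, y)"] assms
  have "2 * gauge_circumradius {x, y} P \<le> gauge_diameter K P"
    by (simp add: gauge_diameter_def)
  then have "2 * gauge_circumradius {x, y} P * width \<le> gauge_diameter K P * width"
    using width_pos by (simp add: mult_right_mono)
  then show ?thesis using pair_circumradius_ge[of k x y] by simp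
qed

lemma diameter_le:
  assumes "K \<noteq> {}" and "\<And>x y k. x \<in> K \<Longrightarrow> y \<in> K \<Longrightarrow> \<bar>dir \<theta> k \<bullet> (x - y)\<bar> \<le> W"
  shows "gauge_diameter K P \<le> 2 * W / width"
proof -
  have "(SUP (x, y) \<in> K \<times> K. gauge_circumradius {x, y} P) \<le> W / width"
  proof (rule cSUP_least)
    fix p assume "p \<in> K \<times> K"
    then show "(case p of (x, y) \<Rightarrow> gauge_circumradius {x, y} P) \<le> W / width"
      using assms(2) width_pos by (auto intro!: fits_imp_circumradius_le pair_fitsI)
  qed (use assms(1) in auto)
  then show ?thesis by (simp add: gauge_diameter_def)
qed

lemma hull_diameter_le:
  assumes "S \<noteq> {}" and W: "\<And>x y k. x \<in> S \<Longrightarrow> y \<in> S \<Longrightarrow> dir \<theta> k \<bullet> (x - y) \<le> W"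
  shows "gauge_diameter (convex hull S) P \<le> 2 * W / width"
proof (rule diameter_le)
  show "convex hull S \<noteq> {}" using assms(1) by simp
  have "dir \<theta> k \<bullet> (x - y) \<le> W" if x: "x \<in> convex hull S" and y: "y \<in> convex hull S" for x y k
  proof -
    have "dir \<theta> k \<bullet> x \<le> W + dir \<theta> k \<bullet> v" if "v \<in> S" for v
    proof -
      have "convex hull S \<subseteq> {u. dir \<theta> k \<bullet> u \<le> W + dir \<theta> k \<bullet> v}"
        using W[OF _ that, of _ k] by (intro hull_minimal convex_halfspace_le) (auto simp: inner_diff_right algebra_simps)
      then show ?thesis using x by auto
    qed
    then have "convex hull S \<subseteq> {u. dir \<theta> k \<bullet> u \<ge> dir \<theta> k \<bullet> x - W}"
      by (intro hull_minimal convex_halfspace_ge) (auto simp: algebra_simps)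
    then show ?thesis using y by (auto simp: inner_diff_right)
  qed
  from this this[of y x for x y] show "\<bar>dir \<theta> k \<bullet> (x - y)\<bar> \<le> W"
    if "x \<in> convex hull S" "y \<in> convex hull S" for x y k
    using that by (auto simp: abs_le_iff inner_diff_right)
qed

lemma hull_diameter_eq:
  assumes "finite S" "x \<in> S" "y \<in> S" "dir \<theta> k \<bullet> (x - y) = W"
    and W: "\<And>x y k. x \<in> S \<Longrightarrow> y \<in> S \<Longrightarrow> dir \<theta> k \<bullet> (x - y) \<le> W"
  shows "gauge_diameter (convex hull S) P = 2 * W / width"
proof (rule antisym)
  show "gauge_diameter (convex hull S) P \<le> 2 * W / width"
    using assms(2) W by (intro hull_diameter_le) auto
  have "bounded (convex hull S)" using assms(1) by (intro bounded_convex_hull finite_imp_bounded)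
  then have "2 * \<bar>dir \<theta> k \<bullet> (x - y)\<bar> \<le> gauge_diameter (convex hull S) P * width"
    using assms(2,3) by (intro diameter_ge) (auto intro: hull_inc)
  then have "2 * W \<le> gauge_diameter (convex hull S) P * width" using assms(4) by simp
  then show "2 * W / width \<le> gauge_diameter (convex hull S) P"
    using width_pos by (simp add: pos_divide_le_eq)
qed

section \<open>The inequality and its equality case\<close>

text \<open>The two inner products in \<open>triple_imp_fits\<close> are each at most \<open>D(K, P)\<close> times half the width
  of \<open>P\<close>.\<close>

lemma compact_fits_diameter:
  assumes K: "compact K" "K \<noteq> {}"
  shows "fits K (gauge_diameter K P / golden)"
proof (rule triple_imp_fits[OF K])
  note ge = diameter_ge[OF compact_imp_bounded[OF K(1)]]
  obtain x where "x \<in> K" using K by auto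
  from ge[OF this this, of 0] have "0 \<le> gauge_diameter K P" using width_pos by (simp add: zero_le_mult_iff)
  then show "0 \<le> gauge_diameter K P / golden" using golden_gt_1 by simp
  fix k x y z assume "x \<in> K" "y \<in> K" "z \<in> K"
  then show "dir \<theta> (k + 2) \<bullet> (x - y) + dir \<theta> (k - 2) \<bullet> (x - z)
      \<le> gauge_diameter K P / golden * (golden * width)"
    using ge[of x y "k + 2"] ge[of x z "k - 2"] golden_gt_1 by simp
qed

text \<open>If both inner products in the criterion attain the largest width \<open>W\<close> of \<open>S\<close>, no dilate smaller than
  \<open>D / \<phi>\<close> can satisfy it.\<close>

lemma hull_circumradius_eq:
  assumes S: "finite S" "x \<in> S" "y \<in> S" "z \<in> S"
    and xy: "dir \<theta> (k + 2) \<bullet> (x - y) = W" and xz: "dir \<theta> (k - 2) \<bullet> (x - z) = W"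
    and W: "\<And>x y k. x \<in> S \<Longrightarrow> y \<in> S \<Longrightarrow> dir \<theta> k \<bullet> (x - y) \<le> W"
  shows "gauge_circumradius (convex hull S) P = gauge_diameter (convex hull S) P / golden"
proof (rule antisym)
  have f: "fits (convex hull S) (gauge_diameter (convex hull S) P / golden)"
    using S by (intro compact_fits_diameter finite_imp_compact_convex_hull) auto
  then show "gauge_circumradius (convex hull S) P \<le> gauge_diameter (convex hull S) P / golden"
    by (rule fits_imp_circumradius_le)
  show "gauge_diameter (convex hull S) P / golden \<le> gauge_circumradius (convex hull S) P"
  proof (rule circumradius_geI[OF f])
    fix l assume "fits (convex hull S) l"
    from fits_imp_triple[OF this, of x y z k] S xy xz have "2 * W \<le> l * (golden * width)"
      by (simp add: hull_inc)
    moreover have "gauge_diameter (convex hull S) P = 2 * W / width"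
      using S xy W by (intro hull_diameter_eq) auto
    ultimately have "gauge_diameter (convex hull S) P * width \<le> (l * golden) * width"
      using width_pos by (simp add: mult_ac)
    then show "gauge_diameter (convex hull S) P / golden \<le> l"
      using golden_gt_1 width_pos by (simp add: pos_divide_le_eq)
  qed
qed

end

section \<open>Extremal triangles\<close>

lemma dir_inner_table:
  "dir \<theta> 0 \<bullet> dir \<theta> 0 = 1" "dir \<theta> 1 \<bullet> dir \<theta> 1 = 1" "dir \<theta> 2 \<bullet> dir \<theta> 2 = 1"
  "dir \<theta> 3 \<bullet> dir \<theta> 3 = 1" "dir \<theta> 4 \<bullet> dir \<theta> 4 = 1"
  "dir \<theta> 0 \<bullet> dir \<theta> 1 = (golden - 1) / 2" "dir \<theta> 1 \<bullet> dir \<theta> 0 = (golden - 1) / 2"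
  "dir \<theta> 1 \<bullet> dir \<theta> 2 = (golden - 1) / 2" "dir \<theta> 2 \<bullet> dir \<theta> 1 = (golden - 1) / 2"
  "dir \<theta> 2 \<bullet> dir \<theta> 3 = (golden - 1) / 2" "dir \<theta> 3 \<bullet> dir \<theta> 2 = (golden - 1) / 2"
  "dir \<theta> 3 \<bullet> dir \<theta> 4 = (golden - 1) / 2" "dir \<theta> 4 \<bullet> dir \<theta> 3 = (golden - 1) / 2"
  "dir \<theta> 4 \<bullet> dir \<theta> 0 = (golden - 1) / 2" "dir \<theta> 0 \<bullet> dir \<theta> 4 = (golden - 1) / 2"
  "dir \<theta> 0 \<bullet> dir \<theta> 2 = - golden / 2" "dir \<theta> 2 \<bullet> dir \<theta> 0 = - golden / 2"
  "dir \<theta> 1 \<bullet> dir \<theta> 3 = - golden / 2" "dir \<theta> 3 \<bullet> dir \<theta> 1 = - golden / 2"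
  "dir \<theta> 2 \<bullet> dir \<theta> 4 = - golden / 2" "dir \<theta> 4 \<bullet> dir \<theta> 2 = - golden / 2"
  "dir \<theta> 0 \<bullet> dir \<theta> 3 = - golden / 2" "dir \<theta> 3 \<bullet> dir \<theta> 0 = - golden / 2"
  "dir \<theta> 1 \<bullet> dir \<theta> 4 = - golden / 2" "dir \<theta> 4 \<bullet> dir \<theta> 1 = - golden / 2"
  using dir_inner_0[of \<theta>] dir_inner_1[of \<theta> 0] dir_inner_1[of \<theta> 1] dir_inner_1[of \<theta> 2] dir_inner_1[of \<theta> 3]
    dir_inner_4[of \<theta> 0] dir_inner_2[of \<theta> 0] dir_inner_2[of \<theta> 1] dir_inner_2[of \<theta> 2]
    dir_inner_3[of \<theta> 0] dir_inner_3[of \<theta> 1]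
  by (simp_all add: inner_commute)

lemma regular_pentagon_imp_gauge:
  assumes "regular_pentagon P"
  shows "\<exists>c r \<theta>. pentagon_gauge P c r \<theta>"
proof -
  obtain c r \<theta> where r: "r > 0" and P: "P = convex hull ((\<lambda>k::nat. c + r *\<^sub>R
           (vector [cos (\<theta> + 2 * pi * real k / 5), sin (\<theta> + 2 * pi * real k / 5)] :: real ^ 2)) ` {..<5})"
    using assms unfolding regular_pentagon_def by blast
  have "dir \<theta> j \<in> (\<lambda>k. dir \<theta> (int k)) ` {..<5}" for j
  proof (rule periodic5_cases[where k = 0])
    have "dir \<theta> (int k) \<in> (\<lambda>k. dir \<theta> (int k)) ` {..<5}" if "k < 5" for k using that by auto
    from this[of 0] this[of 1] this[of 2] this[of 3] this[of 4]
    show "dir \<theta> 0 \<in> (\<lambda>k. dir \<theta> (int k)) ` {..<5}" "dir \<theta> (0 + 1) \<in> (\<lambda>k. dir \<theta> (int k)) ` {..<5}"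
      "dir \<theta> (0 + 2) \<in> (\<lambda>k. dir \<theta> (int k)) ` {..<5}" "dir \<theta> (0 + 3) \<in> (\<lambda>k. dir \<theta> (int k)) ` {..<5}"
      "dir \<theta> (0 + 4) \<in> (\<lambda>k. dir \<theta> (int k)) ` {..<5}"
      by simp_all
  qed (simp add: dir_add5)
  then have range: "range (dir \<theta>) = (\<lambda>k. dir \<theta> (int k)) ` {..<5}" by auto
  have "P = convex hull ((\<lambda>z. c + r *\<^sub>R z) ` range (dir \<theta>))"
    unfolding P range image_image by (simp add: dir_def)
  then have "pentagon_gauge P c r \<theta>"
    using r by unfold_locales (simp_all add: convex_hull_affinity)
  then show ?thesis by blast
qed

context pentagon_gauge
begin

text \<open>Up to size and position, this is the golden triangle formed by a side and two diagonals of
  \<open>- P\<close>. Each of the diagonals runs from a vertex to an endpoint of the opposite edge, so it spans the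
  full width of the pentagon in the direction of that vertex; the base spans less in all five directions.\<close>

lemma golden_triangle_attains:
  fixes u v w :: "real ^ 2"
  defines "u \<equiv> - dir \<theta> 0" and "v \<equiv> - dir \<theta> 2" and "w \<equiv> - dir \<theta> 3"
  shows "is_triangle u v w"
    and "gauge_circumradius (triangle_hull u v w) P = gauge_diameter (triangle_hull u v w) P / golden"
    and "isosceles u v w"
    and "card (diametrical_edges u v w P) = 2"
proof -
  define W where "W = 1 + golden / 2"
  have vals:
    "dir \<theta> 0 \<bullet> u = - 1" "dir \<theta> 0 \<bullet> v = golden / 2" "dir \<theta> 0 \<bullet> w = golden / 2"
    "dir \<theta> 1 \<bullet> u = (1 - golden) / 2" "dir \<theta> 1 \<bullet> v = (1 - golden) / 2" "dir \<theta> 1 \<bullet> w = golden / 2"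
    "dir \<theta> 2 \<bullet> u = golden / 2" "dir \<theta> 2 \<bullet> v = - 1" "dir \<theta> 2 \<bullet> w = (1 - golden) / 2"
    "dir \<theta> 3 \<bullet> u = golden / 2" "dir \<theta> 3 \<bullet> v = (1 - golden) / 2" "dir \<theta> 3 \<bullet> w = - 1"
    "dir \<theta> 4 \<bullet> u = (1 - golden) / 2" "dir \<theta> 4 \<bullet> v = golden / 2" "dir \<theta> 4 \<bullet> w = (1 - golden) / 2"
    by (simp_all add: u_def v_def w_def dir_inner_table field_simps)
  have W: "dir \<theta> k \<bullet> (x - y) \<le> W" if "x \<in> {u, v, w}" "y \<in> {u, v, w}" for x y k
    by (rule periodic5_cases[where k = 0])
      (use that golden_bounds in \<open>auto simp: dir_add5 W_def inner_diff_right vals field_simps\<close>)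
  have ab: "dir \<theta> 2 \<bullet> (u - v) = W" and ac: "dir \<theta> 3 \<bullet> (u - w) = W"
    by (simp_all add: W_def inner_diff_right vals)
  show "gauge_circumradius (triangle_hull u v w) P = gauge_diameter (triangle_hull u v w) P / golden"
    unfolding triangle_hull_def
    by (rule hull_circumradius_eq[where x = u and y = v and z = w and k = 0 and W = W])
      (use ab ac W dir_add5[of \<theta> "-2"] in auto)
  have T: "gauge_diameter (triangle_hull u v w) P = 2 * W / width"
    unfolding triangle_hull_def by (rule hull_diameter_eq[OF _ _ _ ab W]) auto
  have d_ab: "gauge_diameter (closed_segment u v) P = 2 * W / width"
    unfolding segment_convex_hull by (rule hull_diameter_eq[OF _ _ _ ab W]) auto
  have d_ca: "gauge_diameter (closed_segment w u) P = 2 * W / width"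
    unfolding segment_convex_hull by (rule hull_diameter_eq[OF _ _ _ ac W]) auto
  \<comment> \<open>The largest width of the base is \<open>\<bar>e\<^sub>1 \<bullet> (v - w)\<bar> = \<phi> - 1/2\<close>.\<close>
  have "gauge_diameter (closed_segment v w) P \<le> 2 * (golden - 1 / 2) / width"
    unfolding segment_convex_hull
  proof (rule hull_diameter_le)
    fix x y k assume xy: "x \<in> {v, w}" "y \<in> {v, w}"
    show "dir \<theta> k \<bullet> (x - y) \<le> golden - 1 / 2"
      by (rule periodic5_cases[where k = 0])
        (use xy golden_bounds in \<open>auto simp: dir_add5 inner_diff_right vals field_simps\<close>)
  qed simp
  also have "\<dots> < 2 * W / width"
    using width_pos golden_bounds by (simp add: W_def divide_strict_right_mono)
  finally have d_bc: "gauge_diameter (closed_segment v w) P \<noteq> 2 * W / width" by simp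
  show tri: "is_triangle u v w"
  proof -
    have "u - v \<noteq> 0" using ab golden_gt_1 by (auto simp: W_def)
    moreover have "w - v \<noteq> 0"
    proof
      assume "w - v = 0"
      then have "dir \<theta> 2 \<bullet> (w - v) = 0" by simp
      then show False using golden_gt_1 golden_bounds by (simp add: inner_diff_right vals field_simps)
    qed
    moreover have "w - v \<noteq> s *\<^sub>R (u - v)" for s
    proof
      assume eq: "w - v = s *\<^sub>R (u - v)"
      have "dir \<theta> 0 \<bullet> (w - v) = s * (dir \<theta> 0 \<bullet> (u - v))" by (simp add: eq)
      then have "s = 0" using golden_gt_1 by (simp add: inner_diff_right vals)
      then show False using eq \<open>w - v \<noteq> 0\<close> by simp
    qed
    ultimately show ?thesis by (simp add: is_triangle_def collinear_3[of u v w] collinear_lemma)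
  qed
  have "(u - v) \<bullet> (u - v) = (u - w) \<bullet> (u - w)"
    by (simp add: u_def v_def w_def inner_diff_right inner_diff_left dir_inner_table)
  then show "isosceles u v w" by (simp add: isosceles_def dist_norm norm_eq_sqrt_inner)
  have "diametrical_edges u v w P = {closed_segment u v, closed_segment w u}"
    unfolding diametrical_edges_def triangle_edges_def T using d_ab d_bc d_ca by auto
  moreover have "v \<noteq> w" using tri by (auto simp: is_triangle_def)
  then have "closed_segment u v \<noteq> closed_segment w u" by (auto simp: closed_segment_eq doubleton_eq_iff)
  ultimately show "card (diametrical_edges u v w P) = 2" by simp
qed

text \<open>The length of the edge \<open>v w\<close>, parallel to a diagonal of \<open>P\<close>, is chosen so that its width
  \<open>e\<^sub>1 \<bullet> (w - v)\<close> is \<open>W = 1 + \<phi>/2\<close>. The apex \<open>u = - m e\<^sub>0\<close> lies on the symmetry axis, and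
  \<open>e\<^sub>2 \<bullet> (u - v) = W\<close> reads \<open>m \<phi>/2 + (2\<phi> - 1)/4 = 1 + \<phi>/2\<close>, so \<open>m = 5/(2\<phi>) = 5 (\<phi> - 1)/2\<close>.\<close>

lemma equilateral_triangle_attains:
  fixes u v w :: "real ^ 2"
  defines "u \<equiv> - (5 / 2 * (golden - 1)) *\<^sub>R dir \<theta> 0"
    and "v \<equiv> - (1 / 2) *\<^sub>R (dir \<theta> 1 - dir \<theta> 4)" and "w \<equiv> (1 / 2) *\<^sub>R (dir \<theta> 1 - dir \<theta> 4)"
  shows "is_triangle u v w"
    and "gauge_circumradius (triangle_hull u v w) P = gauge_diameter (triangle_hull u v w) P / golden"
    and "equilateral_wrt P u v w"
proof -
  define W where "W = 1 + golden / 2"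
  have vals:
    "dir \<theta> 0 \<bullet> u = - (5 / 2 * (golden - 1))" "dir \<theta> 1 \<bullet> u = - (5 / 4 * (2 - golden))"
    "dir \<theta> 2 \<bullet> u = 5 / 4" "dir \<theta> 3 \<bullet> u = 5 / 4" "dir \<theta> 4 \<bullet> u = - (5 / 4 * (2 - golden))"
    "dir \<theta> 0 \<bullet> w = 0" "dir \<theta> 1 \<bullet> w = (1 + golden / 2) / 2" "dir \<theta> 2 \<bullet> w = (2 * golden - 1) / 4"
    "dir \<theta> 3 \<bullet> w = - ((2 * golden - 1) / 4)" "dir \<theta> 4 \<bullet> w = - ((1 + golden / 2) / 2)"
    using golden_square
    by (simp_all add: u_def w_def inner_diff_right dir_inner_table field_simps)
  have v: "dir \<theta> k \<bullet> v = - (dir \<theta> k \<bullet> w)" for k by (simp add: v_def w_def)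
  have W: "dir \<theta> k \<bullet> (x - y) \<le> W" if "x \<in> {u, v, w}" "y \<in> {u, v, w}" for x y k
    by (rule periodic5_cases[where k = 0])
      (use that golden_bounds in \<open>auto simp: dir_add5 W_def v inner_diff_right vals field_simps\<close>)
  have ab: "dir \<theta> 2 \<bullet> (u - v) = W" and ac: "dir \<theta> 3 \<bullet> (u - w) = W" and cb: "dir \<theta> 1 \<bullet> (w - v) = W"
    by (simp_all add: W_def v inner_diff_right vals field_simps)
  show "gauge_circumradius (triangle_hull u v w) P = gauge_diameter (triangle_hull u v w) P / golden"
    unfolding triangle_hull_def
    by (rule hull_circumradius_eq[where x = u and y = v and z = w and k = 0 and W = W])
      (use ab ac W dir_add5[of \<theta> "-2"] in auto)
  have "gauge_diameter (closed_segment u v) P = 2 * W / width"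
    unfolding segment_convex_hull by (rule hull_diameter_eq[OF _ _ _ ab W]) auto
  moreover have "gauge_diameter (closed_segment w u) P = 2 * W / width"
    unfolding segment_convex_hull by (rule hull_diameter_eq[OF _ _ _ ac W]) auto
  moreover have "gauge_diameter (closed_segment v w) P = 2 * W / width"
    unfolding segment_convex_hull by (rule hull_diameter_eq[OF _ _ _ cb W]) auto
  ultimately show "equilateral_wrt P u v w"
    by (auto simp: equilateral_wrt_def triangle_edges_def)
  have "u - v \<noteq> 0" using ab golden_gt_1 by (auto simp: W_def)
  moreover have "w - v \<noteq> 0" using cb golden_gt_1 by (auto simp: W_def)
  moreover have "w - v \<noteq> s *\<^sub>R (u - v)" for s
  proof
    assume eq: "w - v = s *\<^sub>R (u - v)"
    have "dir \<theta> 0 \<bullet> (w - v) = s * (dir \<theta> 0 \<bullet> (u - v))" by (simp add: eq)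
    moreover have "dir \<theta> 0 \<bullet> (w - v) = 0" "dir \<theta> 0 \<bullet> (u - v) = - (5 / 2 * (golden - 1))"
      by (simp_all add: v inner_diff_right vals)
    ultimately have "s = 0" using golden_gt_1 by simp
    then show False using eq \<open>w - v \<noteq> 0\<close> by simp
  qed
  ultimately show "is_triangle u v w" by (simp add: is_triangle_def collinear_3[of u v w] collinear_lemma)
qed

end

section \<open>The Jung-type inequality for the regular pentagon\<close>

theorem theorem1p6:
  fixes P :: "(real ^ 2) set"
  assumes "regular_pentagon P"
  shows "(\<forall>K :: (real ^ 2) set. convex_body K \<longrightarrow>
            gauge_circumradius K P \<le> 2 / (1 + sqrt 5) * gauge_diameter K P \<and>
            2 / (1 + sqrt 5) * gauge_diameter K P = (sqrt 5 - 1) / 2 * gauge_diameter K P)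
       \<and> (\<exists>a b c. is_triangle a b c
            \<and> gauge_circumradius (triangle_hull a b c) P
                = 2 / (1 + sqrt 5) * gauge_diameter (triangle_hull a b c) P
            \<and> isosceles a b c
            \<and> card (diametrical_edges a b c P) = 2)
       \<and> (\<exists>a b c. is_triangle a b c
            \<and> gauge_circumradius (triangle_hull a b c) P
                = 2 / (1 + sqrt 5) * gauge_diameter (triangle_hull a b c) P
            \<and> equilateral_wrt P a b c)"
proof -
  obtain c r \<theta> where "pentagon_gauge P c r \<theta>" using regular_pentagon_imp_gauge[OF assms] by blast
  then interpret pentagon_gauge P c r \<theta> .
  have g: "2 / (1 + sqrt 5) * d = d / golden" for d by (simp add: golden_def)
  have "1 / golden = golden - 1" using golden_square golden_gt_1 by (simp add: field_simps)
  moreover have "golden - 1 = (sqrt 5 - 1) / 2" by (simp add: golden_def field_simps)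
  ultimately have g': "d / golden = (sqrt 5 - 1) / 2 * d" for d
    by (metis mult.commute times_divide_eq_right mult.right_neutral)
  have bound: "gauge_circumradius K P \<le> gauge_diameter K P / golden" if "convex_body K" for K
    using that by (intro fits_imp_circumradius_le compact_fits_diameter) (auto simp: convex_body_def)
  show ?thesis
    unfolding g
    using bound g' golden_triangle_attains equilateral_triangle_attains by blast
qed

end
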